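(* Let $0<|q|<1$ and let $a,b,c,d,e$ be complex numbers satisfying $0<|cde|<|abq|$ and $c,d,e\neq -aq^{-m},-bq^{-n}$ for all integers $n,m\ge 0$. Define $$\rho(a,b;c,d,e)=\sum_{k=0}^{\infty}\left(1-\frac{aq^{2k+1}}{b}\right)\frac{(-1/b;q)_{k+1}}{(-c/b,-d/b,-e/b;q)_{k+1}}\cdot\frac{(-aq/c,-aq/d,-aq/e;q)_k}{(-aq;q)_k}\left(\frac{cde}{abq}\right)^k.$$ Suppose moreover that at least one of $c,\,-aq/d,\,-aq/e$ equals $q^{-m}$ for some integer $m\ge 0$. Then $$\rho(a,b;c,d,e)=\frac{1+b}{(b+c)(1-de/(abq))}\sum_{k=0}^{\infty}\frac{(c,-aq/d,-aq/e;q)_k}{(-aq,-cq/b,abq^2/(de);q)_k}q^k.$$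
   Context: For complex $x$ and integer $n\ge 0$: $(x;q)_\infty=\prod_{j=0}^{\infty}(1-xq^j)$, $(x;q)_n=(x;q)_\infty/(xq^n;q)_\infty$, and $(x_1,\dots,x_m;q)_n=(x_1;q)_n\cdots(x_m;q)_n$.
   Formalization: The formal theorem also assumes -aq ≠ q^{-m} for all integers m ≥ 0, so that the denominators (-aq;q)_k in both series never vanish; without this the terms of the series are undefined (for example a = -1/q, c = 1). *)

theory Defs
  imports "HOL-Analysis.Analysis"
begin

definition qpoch_inf :: "complex \<Rightarrow> complex \<Rightarrow> complex" where
  "qpoch_inf x q = (\<Prod>j. 1 - x * q ^ j)"

text \<open>
  The quotient $(x;q)_\infty / (xq^n;q)_\infty$ has the form $0/0$ when $x = q^{-m}$ with
  $m \ge n$, a case that matters for terminating series.  The finite product is its value there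
  by continuity; \<open>qpoch_eq_quotient\<close> shows that both agree everywhere else.
\<close>

definition qpoch :: "complex \<Rightarrow> complex \<Rightarrow> nat \<Rightarrow> complex" where
  "qpoch x q n = (\<Prod>j<n. 1 - x * q ^ j)"

definition qpochs :: "complex list \<Rightarrow> complex \<Rightarrow> nat \<Rightarrow> complex" where
  "qpochs xs q n = (\<Prod>x\<leftarrow>xs. qpoch x q n)"

definition rho :: "complex \<Rightarrow> complex \<Rightarrow> complex \<Rightarrow> complex \<Rightarrow> complex \<Rightarrow> complex \<Rightarrow> complex" where
  "rho q a b c d e =
     (\<Sum>k. (1 - a * q ^ (2 * k + 1) / b)
          * (qpoch (- 1 / b) q (k + 1) / qpochs [- c / b, - d / b, - e / b] q (k + 1))
          * (qpochs [- a * q / c, - a * q / d, - a * q / e] q k / qpoch (- a * q) q k)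
          * (c * d * e / (a * b * q)) ^ k)"

lemma convergent_prod_qpoch:
  assumes "norm q < 1"
  shows "convergent_prod (\<lambda>j. 1 - x * q ^ j :: complex)"
proof -
  have "summable (\<lambda>j. norm x * norm q ^ j)"
    using assms by (intro summable_mult summable_geometric) auto
  then have "summable (\<lambda>j. norm ((1 - x * q ^ j) - 1))"
    by (simp add: norm_mult norm_power)
  then show ?thesis
    by (intro abs_convergent_prod_imp_convergent_prod summable_imp_abs_convergent_prod)
qed

lemma qpoch_inf_split:
  assumes "norm q < 1"
  shows "qpoch_inf x q = qpoch x q n * qpoch_inf (x * q ^ n) q"
proof -
  have lim: "(\<lambda>N. \<Prod>j\<le>N. 1 - y * q ^ j) \<longlonglongrightarrow> qpoch_inf y q" for y
    unfolding qpoch_inf_def by (intro convergent_prod_LIMSEQ convergent_prod_qpoch assms)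
  have split: "(\<Prod>j\<le>N + n. 1 - x * q ^ j) = qpoch x q n * (\<Prod>j\<le>N. 1 - x * q ^ n * q ^ j)" for N
  proof (induction N)
    case 0
    have "{..n} = insert n {..<n}" by auto
    then show ?case by (simp add: qpoch_def)
  next
    case (Suc N)
    then show ?case by (simp add: power_add mult_ac)
  qed
  have "(\<lambda>N. \<Prod>j\<le>N + n. 1 - x * q ^ j) \<longlonglongrightarrow> qpoch x q n * qpoch_inf (x * q ^ n) q"
    unfolding split by (intro tendsto_mult_left lim)
  moreover have "(\<lambda>N. \<Prod>j\<le>N + n. 1 - x * q ^ j) \<longlonglongrightarrow> qpoch_inf x q"
    using LIMSEQ_ignore_initial_segment[OF lim[of x], of n] .
  ultimately show ?thesis
    using LIMSEQ_unique by blast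
qed

lemma qpoch_eq_quotient:
  assumes "norm q < 1" and "qpoch_inf (x * q ^ n) q \<noteq> 0"
  shows "qpoch x q n = qpoch_inf x q / qpoch_inf (x * q ^ n) q"
  using assms by (simp add: qpoch_inf_split[OF assms(1), of x n])

end

theory Submission
  imports Defs
begin

text \<open>
  With \<open>A = aq/b\<close>, \<open>D = -aq/d\<close>, \<open>E = -aq/e\<close> and \<open>z = de/(abq)\<close>, the series \<open>\<rho>\<close> is a very-well-poised
  \<open>\<^sub>8\<phi>\<^sub>7\<close> with base \<open>A\<close> in which one parameter is \<open>q\<close>, and the claim is Watson's transformation for it.
  The q-Saalschuetz sum expands the factor \<open>(-q/b, -aq/c; q)\<^sub>k c\<^sup>k / (-aq, -cq/b; q)\<^sub>k\<close> in the functions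
  \<open>\<phi>\<^sub>j(k) = (q\<^bsup>-k\<^esup>, Aq\<^sup>k; q)\<^sub>j\<close>. The sum over \<open>k\<close> of the remaining well-poised weight times \<open>\<phi>\<^sub>j(k)\<close>
  telescopes for \<open>j = 0\<close>, and satisfies a first-order recurrence in \<open>j\<close> up to a telescoping term.
  Working with partial sums over \<open>k\<close>, only finite sums are interchanged. The boundary terms tend to 0 for the
  relevant \<open>j \<le> m\<close>: for \<open>c = q\<^bsup>-m\<^esup>\<close> because the hypothesis on \<open>|cde|\<close> says \<open>|z| < |q|\<^sup>m\<close>, and for
  \<open>D = q\<^bsup>-m\<^esup>\<close> or \<open>E = q\<^bsup>-m\<^esup>\<close> because they vanish eventually.
\<close>

section \<open>Finite and infinite q-shifted factorials: recurrences, zeros and limits\<close>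

lemma qpoch_0 [simp]: "qpoch x q 0 = 1"
  by (simp add: qpoch_def)

lemma qpoch_Suc: "qpoch x q (Suc n) = qpoch x q n * (1 - x * q ^ n)"
  by (simp add: qpoch_def)

lemma qpoch_Suc_left: "qpoch x q (Suc n) = (1 - x) * qpoch (x * q) q n"
  unfolding qpoch_def prod.lessThan_Suc_shift by (simp add: mult_ac)

lemma qpoch_nonzero: "(\<And>j. x * q ^ j \<noteq> 1) \<Longrightarrow> qpoch x q n \<noteq> 0"
  by (metis (no_types, lifting) eq_iff_diff_eq_0 finite_lessThan prod_zero_iff qpoch_def)

lemma qpoch_eq_0: "x * q ^ j = 1 \<Longrightarrow> j < n \<Longrightarrow> qpoch x q n = 0"
  unfolding qpoch_def by (rule prod_zero) auto

lemma qpoch_eq_0_mono: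
  assumes "qpoch x q j = 0" "j \<le> k"
  shows "qpoch x q k = 0"
proof -
  from assms(1) obtain i where "i < j" "1 - x * q ^ i = 0"
    by (auto simp: qpoch_def)
  with assms(2) show ?thesis
    by (intro qpoch_eq_0[of x q i]) auto
qed

lemma qpoch_inverse_power_eq_0: "q \<noteq> 0 \<Longrightarrow> m < n \<Longrightarrow> qpoch (1 / q ^ m) q n = 0"
  by (rule qpoch_eq_0[of _ _ m]) auto

lemma qpoch_tendsto:
  assumes "norm q < 1"
  shows "(\<lambda>n. qpoch x q n) \<longlonglongrightarrow> qpoch_inf x q"
proof -
  have "(\<lambda>n. \<Prod>j\<le>n. 1 - x * q ^ j) \<longlonglongrightarrow> qpoch_inf x q"
    unfolding qpoch_inf_def by (intro convergent_prod_LIMSEQ convergent_prod_qpoch assms)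
  then have "(\<lambda>n. qpoch x q (Suc n)) \<longlonglongrightarrow> qpoch_inf x q"
    by (simp add: qpoch_def lessThan_Suc_atMost)
  then show ?thesis
    by (rule LIMSEQ_imp_Suc)
qed

lemma qpoch_inf_nonzero:
  assumes "norm q < 1" "\<And>j. x * q ^ j \<noteq> 1"
  shows "qpoch_inf x q \<noteq> 0"
  unfolding qpoch_inf_def
  using assms by (intro prodinf_nonzero convergent_prod_qpoch) auto

section \<open>The terminating q-Saalschuetz sum\<close>

text \<open>Summand of the \<open>3phi2\<close> series with upper parameters \<open>q^(-n)\<close>,
  \<open>A q^n\<close>, \<open>c\<close> and lower parameters \<open>P\<close>, \<open>R\<close>, at
  argument \<open>q\<close>. It is balanced exactly when \<open>P * R = A * q * c\<close>.\<close>

definition saal_term :: "complex \<Rightarrow> complex \<Rightarrow> complex \<Rightarrow> complex \<Rightarrow> complex \<Rightarrow> nat \<Rightarrow> nat \<Rightarrow> complex" where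
  "saal_term q A c P R n j =
     qpoch (1 / q ^ n) q j * qpoch (A * q ^ n) q j * qpoch c q j
       / (qpoch q q j * qpoch P q j * qpoch R q j) * q ^ j"

text \<open>A creative-telescoping certificate: it yields a first-order recurrence in
  \<open>n\<close> for the full sum, since the factor \<open>(q^(-n); q)_N\<close> on the right
  vanishes for \<open>N > n\<close>. Induction on \<open>N\<close> reduces it to a polynomial
  identity modulo \<open>P * R = A * q * c\<close>.\<close>

lemma saal_telescope:
  fixes q A c P R :: complex
  assumes q: "q \<noteq> 0" and q1: "\<And>j. q * q ^ j \<noteq> 1"
    and P: "\<And>j. P * q ^ j \<noteq> 1" and R: "\<And>j. R * q ^ j \<noteq> 1"
    and PR: "P * R = A * q * c"
  shows "(\<Sum>j<Suc N. (1 - P * q ^ n) * (1 - R * q ^ n) * saal_term q A c P R (Suc n) j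
           - (c - q ^ n * (P + R) + A * q ^ (2 * n + 1)) * saal_term q A c P R n j)
    = (1 - A * q ^ (2 * n + 1)) * qpoch (1 / q ^ n) q N * qpoch (A * q ^ Suc n) q N * qpoch c q (Suc N)
        / (qpoch q q N * qpoch P q N * qpoch R q N)"
proof (induction N)
  case 0
  have "(1 - P * s) * (1 - R * s) - (c - s * (P + R) + A * q * s\<^sup>2) = (1 - A * q * s\<^sup>2) * (1 - c)" for s
    using PR by algebra
  from this[of "q ^ n"] show ?case
    by (simp add: saal_term_def qpoch_Suc power_mult[symmetric] mult_ac)
next
  case (Suc N)
  define X Y Z where "X = qpoch (1 / q ^ n) q N" and "Y = qpoch (A * q ^ Suc n) q N"
    and "Z = qpoch c q (Suc N)"
  define W where "W = qpoch q q N * qpoch P q N * qpoch R q N"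
  define s y where "s = q ^ n" and "y = q ^ N"
  have nz: "s \<noteq> 0" "y \<noteq> 0" "1 - q * y \<noteq> 0" "1 - P * y \<noteq> 0" "1 - R * y \<noteq> 0" "W \<noteq> 0"
    using q q1 P R by (auto simp: s_def y_def W_def qpoch_nonzero)
  have W': "qpoch q q (Suc N) * qpoch P q (Suc N) * qpoch R q (Suc N)
      = W * ((1 - q * y) * (1 - P * y) * (1 - R * y))"
    by (simp add: W_def y_def qpoch_Suc mult_ac)
  \<comment> \<open>Splitting off the first factor of one product and the last factor of the other
    lets the summands for \<open>n\<close> and \<open>Suc n\<close> share \<open>X\<close>,
    \<open>Y\<close>, \<open>Z\<close> and \<open>W\<close>; in \<open>t2\<close> the roles of first
    and last are swapped.\<close>
  have t1: "saal_term q A c P R (Suc n) (Suc N) =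
     (1 - 1 / (q * s)) * X * (Y * (1 - A * q * s * y)) * Z
       / (W * ((1 - q * y) * (1 - P * y) * (1 - R * y))) * (q * y)"
  proof -
    have "qpoch (1 / q ^ Suc n) q (Suc N) = (1 - 1 / (q * s)) * X"
      using q by (simp add: qpoch_Suc_left X_def s_def)
    moreover have "qpoch (A * q ^ Suc n) q (Suc N) = Y * (1 - A * q * s * y)"
      by (simp add: qpoch_Suc Y_def s_def y_def mult_ac)
    ultimately show ?thesis
      unfolding saal_term_def W' by (simp add: Z_def y_def)
  qed
  have t2: "saal_term q A c P R n (Suc N) =
     (X * (1 - y / s)) * ((1 - A * s) * Y) * Z
       / (W * ((1 - q * y) * (1 - P * y) * (1 - R * y))) * (q * y)"
  proof -
    have "qpoch (1 / q ^ n) q (Suc N) = X * (1 - y / s)"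
      by (simp add: qpoch_Suc X_def s_def y_def)
    moreover have "qpoch (A * q ^ n) q (Suc N) = (1 - A * s) * Y"
      by (simp add: qpoch_Suc_left Y_def s_def mult_ac)
    ultimately show ?thesis
      unfolding saal_term_def W' by (simp add: Z_def y_def)
  qed
  have g: "qpoch (1 / q ^ n) q (Suc N) = X * (1 - y / s)"
      "qpoch (A * q ^ Suc n) q (Suc N) = Y * (1 - A * q * s * y)"
      "qpoch c q (Suc (Suc N)) = Z * (1 - c * q * y)"
    by (simp_all add: qpoch_Suc[of _ _ N] qpoch_Suc[of _ _ "Suc N"] X_def Y_def Z_def s_def y_def mult_ac)
  have pw: "q ^ (2 * n + 1) = q * s\<^sup>2"
    by (simp add: s_def power_mult[symmetric] mult.commute)
  define L where "L = (1 - q * y) * (1 - P * y) * (1 - R * y)"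
  have L: "L \<noteq> 0" using nz by (simp add: L_def)
  \<comment> \<open>The induction step with the common factor \<open>X * Y * Z / (W * L * s)\<close>
    removed; this is where the balancing condition enters.\<close>
  have key: "(1 - P * s) * (1 - R * s) * (q * s - 1) * (1 - A * q * s * y) * y
      - (c - s * (P + R) + A * q * s\<^sup>2) * (s - y) * (1 - A * s) * q * y
      = (1 - A * q * s\<^sup>2) * ((s - y) * (1 - A * q * s * y) * (1 - c * q * y) - L * s)"
    using PR unfolding L_def by algebra
  have "(1 - A * (q * s\<^sup>2)) * X * Y * Z / W
     + ((1 - P * s) * (1 - R * s) * ((1 - 1 / (q * s)) * X * (Y * (1 - A * q * s * y)) * Z / (W * L) * (q * y))
       - (c - s * (P + R) + A * (q * s\<^sup>2)) * ((X * (1 - y / s)) * ((1 - A * s) * Y) * Z / (W * L) * (q * y)))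
     = X * Y * Z / (W * L * s) * ((1 - A * q * s\<^sup>2) * L * s +
      ((1 - P * s) * (1 - R * s) * (q * s - 1) * (1 - A * q * s * y) * y
      - (c - s * (P + R) + A * q * s\<^sup>2) * (s - y) * (1 - A * s) * q * y))"
    using nz L q by (simp add: divide_simps) (simp add: algebra_simps)
  also have "\<dots> = X * Y * Z / (W * L * s) * ((1 - A * q * s\<^sup>2) * ((s - y) * (1 - A * q * s * y) * (1 - c * q * y)))"
    unfolding key by (simp add: algebra_simps)
  also have "\<dots> = (1 - A * (q * s\<^sup>2)) * (X * (1 - y / s)) * (Y * (1 - A * q * s * y)) * (Z * (1 - c * q * y)) / (W * L)"
    using nz L q by (simp add: divide_simps)
  finally show ?case
    unfolding sum.lessThan_Suc[of _ "Suc N"] Suc.IH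
    unfolding t1 t2 g pw W'
    unfolding X_def[symmetric] Y_def[symmetric] Z_def[symmetric] W_def[symmetric] L_def[symmetric]
    unfolding s_def[symmetric] .
qed

text \<open>Both sides equal 1 at \<open>n = 0\<close> and satisfy the same first-order recurrence
  in \<open>n\<close>, the left one by \<open>saal_telescope\<close>.\<close>

theorem q_saalschuetz:
  fixes q A c P R :: complex
  assumes q: "q \<noteq> 0" and q1: "\<And>j. q * q ^ j \<noteq> 1"
    and P: "\<And>j. P * q ^ j \<noteq> 1" and R: "\<And>j. R * q ^ j \<noteq> 1"
    and PR: "P * R = A * q * c" and nz: "P \<noteq> 0" "R \<noteq> 0"
  shows "(\<Sum>j\<le>n. saal_term q A c P R n j) =
    qpoch (A * q / P) q n * qpoch (A * q / R) q n / (qpoch P q n * qpoch R q n) * c ^ n"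
proof (induction n)
  case 0
  show ?case by (simp add: saal_term_def)
next
  case (Suc n)
  define s where "s = q ^ n"
  \<comment> \<open>Taking \<open>N = Suc n\<close> kills the certificate and still covers every
    nonzero term of both sums; the additional term of the sum for \<open>n\<close> is zero.\<close>
  have "(\<Sum>j<Suc (Suc n). (1 - P * q ^ n) * (1 - R * q ^ n) * saal_term q A c P R (Suc n) j
      - (c - q ^ n * (P + R) + A * q ^ (2 * n + 1)) * saal_term q A c P R n j) = 0"
    by (subst saal_telescope[OF q q1 P R PR]) (simp add: qpoch_inverse_power_eq_0[OF q])
  then have "(1 - P * s) * (1 - R * s) * (\<Sum>j\<le>Suc n. saal_term q A c P R (Suc n) j)
      = (c - s * (P + R) + A * q ^ (2 * n + 1)) * (\<Sum>j\<le>Suc n. saal_term q A c P R n j)"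
    unfolding lessThan_Suc_atMost sum_subtractf sum_distrib_left[symmetric] s_def by simp
  also have "(\<Sum>j\<le>Suc n. saal_term q A c P R n j) = (\<Sum>j\<le>n. saal_term q A c P R n j)"
    by (simp add: saal_term_def qpoch_inverse_power_eq_0[OF q])
  \<comment> \<open>The balancing condition makes this coefficient factor, which produces the new
    factors of \<open>(A q / P; q)\<close> and \<open>(A q / R; q)\<close>.\<close>
  also have "c - s * (P + R) + A * q ^ (2 * n + 1) = c * ((1 - A * q / P * s) * (1 - A * q / R * s))"
  proof -
    have pw: "q ^ (2 * n + 1) = q * s\<^sup>2"
      by (simp add: s_def power_mult[symmetric] mult.commute)
    have "(P * R) * (c - s * (P + R) + A * (q * s\<^sup>2)) = c * ((P - A * q * s) * (R - A * q * s))"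
      using PR by algebra
    then show ?thesis
      unfolding pw using nz by (simp add: divide_simps) (simp add: algebra_simps)
  qed
  finally have rec: "(1 - P * s) * (1 - R * s) * (\<Sum>j\<le>Suc n. saal_term q A c P R (Suc n) j)
      = c * ((1 - A * q / P * s) * (1 - A * q / R * s)) * (\<Sum>j\<le>n. saal_term q A c P R n j)" .
  have "1 - P * s \<noteq> 0" "1 - R * s \<noteq> 0"
    using P R by (auto simp: s_def)
  then have "(\<Sum>j\<le>Suc n. saal_term q A c P R (Suc n) j)
      = c * ((1 - A * q / P * s) * (1 - A * q / R * s)) * (\<Sum>j\<le>n. saal_term q A c P R n j)
         / ((1 - P * s) * (1 - R * s))"
    using rec by (metis mult_eq_0_iff nonzero_mult_div_cancel_left)
  then show ?case
    unfolding Suc.IH by (simp add: qpoch_Suc s_def[symmetric] mult_ac)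
qed


section \<open>Telescoping and summation of the well-poised weight\<close>

text \<open>Here \<open>p = A / D\<close> and \<open>r = A / E\<close>, so the weight is
  very-well-poised; the parameter \<open>q\<close> has cancelled \<open>(A; q)_k / (q; q)_k\<close>.
  With \<open>y = q^k\<close>, each term is a difference because \<open>(z - 1) (1 - A y^2) = z (1 -
  D y) (1 - E y) - (1 - p y) (1 - r y)\<close>.\<close>

lemma well_poised_telescope_0:
  fixes q A D E p r z :: complex
  assumes p: "\<And>j. p * q ^ j \<noteq> 1" and r: "\<And>j. r * q ^ j \<noteq> 1"
    and "p = z * E" and "r = z * D" and "A = z * D * E"
  shows "(z - 1) * (\<Sum>k<N. (1 - A * q ^ (2 * k)) * (qpoch D q k * qpoch E q k
             / (qpoch p q (Suc k) * qpoch r q (Suc k))) * z ^ k)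
    = qpoch D q N * qpoch E q N / (qpoch p q N * qpoch r q N) * z ^ N - 1"
proof (induction N)
  case 0
  show ?case by simp
next
  case (Suc N)
  define y where "y = q ^ N"
  define V W where "V = qpoch D q N * qpoch E q N * z ^ N" and "W = qpoch p q N * qpoch r q N"
  have nz: "1 - p * y \<noteq> 0" "1 - r * y \<noteq> 0" "W \<noteq> 0"
    using p r by (auto simp: y_def W_def qpoch_nonzero)
  have "(z - 1) * (1 - A * y\<^sup>2) = z * (1 - D * y) * (1 - E * y) - (1 - p * y) * (1 - r * y)"
    using assms(3-5) by algebra
  then have "V / W - 1 + (z - 1) * ((1 - A * y\<^sup>2) * (V / (W * ((1 - p * y) * (1 - r * y)))))
      = V * (z * (1 - D * y) * (1 - E * y)) / (W * ((1 - p * y) * (1 - r * y))) - 1"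
    using nz by (simp add: divide_simps) algebra
  moreover have "q ^ (N * 2) = y\<^sup>2"
    by (simp add: y_def power_mult)
  ultimately show ?case
    using Suc.IH by (simp add: distrib_left qpoch_Suc y_def[symmetric] V_def W_def mult_ac)
qed

text \<open>The combination of the two summands at \<open>k\<close> is the increment from
  \<open>k\<close> to \<open>k + 1\<close> of the right-hand side, viewed as a function of
  \<open>N\<close>. That function vanishes at \<open>N = 0\<close> because
  \<open>(1; q)_(j+1) = 0\<close>, so no constant remains, unlike in
  \<open>well_poised_telescope_0\<close>.\<close>

lemma well_poised_telescope_Suc:
  fixes q A D E p r z :: complex
  assumes q: "q \<noteq> 0" and z: "z \<noteq> 0"
    and p: "\<And>j. p * q ^ j \<noteq> 1" and r: "\<And>j. r * q ^ j \<noteq> 1"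
    and pE: "p = z * E" and rD: "r = z * D" and A: "A = z * D * E"
  defines "w \<equiv> \<lambda>k. (1 - A * q ^ (2 * k)) * (qpoch D q k * qpoch E q k
             / (qpoch p q (Suc k) * qpoch r q (Suc k))) * z ^ k"
    and "\<phi> \<equiv> \<lambda>j k. qpoch (1 / q ^ k) q j * qpoch (A * q ^ k) q j"
  shows "(1 - q ^ Suc j / z) * (\<Sum>k<N. w k * \<phi> (Suc j) k)
      - (1 - q ^ Suc j) * (1 - D * q ^ j) * (1 - E * q ^ j) * (\<Sum>k<N. w k * \<phi> j k)
    = q ^ Suc j / z * (qpoch D q N * qpoch E q N / (qpoch p q N * qpoch r q N) * z ^ N)
        * qpoch (1 / q ^ N) q (Suc j) * qpoch (A * q ^ N / q) q (Suc j)"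
proof (induction N)
  case 0
  show ?case by (simp add: qpoch_Suc_left)
next
  case (Suc N)
  define y Q where "y = q ^ N" and "Q = q ^ j"
  define V W X where "V = qpoch D q N * qpoch E q N * z ^ N" and "W = qpoch p q N * qpoch r q N"
    and "X = \<phi> j N"
  define L where "L = (1 - p * y) * (1 - r * y)"
  have nz: "L \<noteq> 0" "W \<noteq> 0" "y \<noteq> 0"
    using p r q by (auto simp: L_def y_def W_def qpoch_nonzero)
  have y2: "q ^ (2 * N) = y\<^sup>2"
    by (simp add: y_def power_mult power2_eq_square power_mult_distrib[symmetric])
  have wN: "w N = (1 - A * y\<^sup>2) * (V / (W * L))"
    unfolding w_def y2 by (simp add: qpoch_Suc V_def W_def L_def y_def mult_ac)
  have \<phi>: "\<phi> (Suc j) N = X * ((1 - Q / y) * (1 - A * y * Q))"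
    by (simp add: \<phi>_def X_def qpoch_Suc Q_def y_def mult_ac)
  \<comment> \<open>\<open>G0\<close> and \<open>G1\<close> write the boundary term at
    \<open>N\<close> and at \<open>N + 1\<close> through the common factor \<open>X\<close>, peeling
    a last factor from one product and a first factor from the other.\<close>
  have G0: "qpoch (1 / q ^ N) q (Suc j) * qpoch (A * q ^ N / q) q (Suc j) = X * ((1 - Q / y) * (1 - A * y / q))"
    using q by (simp add: qpoch_Suc[of "1 / q ^ N"] qpoch_Suc_left[of "A * q ^ N / q"] X_def \<phi>_def
       Q_def y_def mult_ac)
  have G1: "qpoch (1 / q ^ Suc N) q (Suc j) * qpoch (A * q ^ Suc N / q) q (Suc j)
      = X * ((1 - 1 / (q * y)) * (1 - A * y * Q))"
    using q by (simp add: qpoch_Suc[of "A * q ^ N"] qpoch_Suc_left[of "1 / (q * q ^ N)"] X_def \<phi>_def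
       Q_def y_def mult_ac)
  have H1: "qpoch D q (Suc N) * qpoch E q (Suc N) / (qpoch p q (Suc N) * qpoch r q (Suc N)) * z ^ Suc N
      = V / (W * L) * (z * (1 - D * y) * (1 - E * y))"
    by (simp add: qpoch_Suc V_def W_def L_def y_def mult_ac)
  have poly: "(1 - A * y\<^sup>2) * ((z - Q * q) * (y - Q) * (1 - A * y * Q) * q
        - z * ((1 - q * Q) * (1 - D * Q) * (1 - E * Q)) * y * q)
      = Q * q * (z * (1 - D * y) * (1 - E * y) * (q * y - 1) * (1 - A * y * Q) - L * (y - Q) * (q - A * y))"
    unfolding L_def A pE rD by (simp add: algebra_simps power2_eq_square)
  \<comment> \<open>Division of \<open>poly\<close> by \<open>z * y * q\<close>, with all other
    factors opaque so that nothing is expanded.\<close>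
  have divided: "F * (a1 / z * (a2 / y * a3) - t) = q * Q / z * (d * (a4 / (q * y) * a3) - L * (a2 / y * (a5 / q)))"
    if "z \<noteq> 0" "y \<noteq> 0" "q \<noteq> 0" "F * (a1 * a2 * a3 * q - z * t * y * q) = Q * q * (d * a4 * a3 - L * a2 * a5)"
    for F a1 a2 a3 a4 a5 t d L y z q Q :: complex
  proof -
    have "F * (a1 / z * (a2 / y * a3) - t) = F * (a1 * a2 * a3 * q - z * t * y * q) / (z * y * q)"
      using that(1-3) by (simp add: field_simps)
    also have "\<dots> = q * Q / z * (d * (a4 / (q * y) * a3) - L * (a2 / y * (a5 / q)))"
      unfolding that(4) using that(1-3) by (simp add: field_simps)
    finally show ?thesis .
  qed
  have key: "(1 - A * y\<^sup>2) * ((1 - q * Q / z) * ((1 - Q / y) * (1 - A * y * Q))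
        - (1 - q * Q) * (1 - D * Q) * (1 - E * Q))
      = q * Q / z * (z * (1 - D * y) * (1 - E * y) * ((1 - 1 / (q * y)) * (1 - A * y * Q))
         - L * ((1 - Q / y) * (1 - A * y / q)))"
  proof -
    have "1 - q * Q / z = (z - Q * q) / z" "1 - Q / y = (y - Q) / y"
      "1 - 1 / (q * y) = (q * y - 1) / (q * y)" "1 - A * y / q = (q - A * y) / q"
      using nz q z by (simp_all add: divide_simps)
    then show ?thesis
      using divided[OF z nz(3) q poly] by simp
  qed
  have distrib: "V / (W * L) * X * (u * (a * b - L * c)) = u * (V / (W * L) * a) * (X * b) - u * (V / W) * (X * c)"
    if "L \<noteq> 0" for L V W X u a b c :: complex
    using that by (simp add: divide_simps) (simp add: algebra_simps)
  have factor: "u * (F * C * (X * B)) - v * (F * C * X) = C * X * (F * (u * B - v))"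
    for u v F C X B :: complex
    by (simp add: algebra_simps)
  have "(1 - q * Q / z) * (w N * \<phi> (Suc j) N) - (1 - q * Q) * (1 - D * Q) * (1 - E * Q) * (w N * \<phi> j N)
      = V / (W * L) * X * ((1 - A * y\<^sup>2) * ((1 - q * Q / z) * ((1 - Q / y) * (1 - A * y * Q))
        - (1 - q * Q) * (1 - D * Q) * (1 - E * Q)))"
    unfolding wN \<phi> X_def[symmetric] by (rule factor)
  also have "\<dots> = q * Q / z * (V / (W * L) * (z * (1 - D * y) * (1 - E * y))) * (X * ((1 - 1 / (q * y)) * (1 - A * y * Q)))
       - q * Q / z * (V / W) * (X * ((1 - Q / y) * (1 - A * y / q)))"
    unfolding key using distrib[of L V W X] nz by blast
  finally have step: "(1 - q * Q / z) * (w N * \<phi> (Suc j) N) - (1 - q * Q) * (1 - D * Q) * (1 - E * Q) * (w N * \<phi> j N)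
     = \<dots>" .
  have IH: "(1 - q * Q / z) * (\<Sum>k<N. w k * \<phi> (Suc j) k)
      - (1 - q * Q) * (1 - D * Q) * (1 - E * Q) * (\<Sum>k<N. w k * \<phi> j k)
    = q * Q / z * (V / W) * (X * ((1 - Q / y) * (1 - A * y / q)))"
    unfolding G0[symmetric] using Suc.IH by (simp add: V_def W_def Q_def mult_ac)
  have add: "u * (S + t) - v * (S' + t') = g'"
    if "u * S - v * S' = g" "u * t - v * t' = g' - g" for u v S S' t t' g g' :: complex
    using that by (simp add: algebra_simps)
  have "(1 - q * Q / z) * (\<Sum>k<Suc N. w k * \<phi> (Suc j) k)
      - (1 - q * Q) * (1 - D * Q) * (1 - E * Q) * (\<Sum>k<Suc N. w k * \<phi> j k)
    = q * Q / z * (V / (W * L) * (z * (1 - D * y) * (1 - E * y))) * (X * ((1 - 1 / (q * y)) * (1 - A * y * Q)))"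
    unfolding sum.lessThan_Suc by (rule add[OF IH step])
  then show ?case
    unfolding H1[symmetric] G1[symmetric] by (simp add: Q_def mult.assoc)
qed

text \<open>Isolates the growth \<open>q^(-n k)\<close>: for \<open>|q| < 1\<close> the remaining
  product converges as \<open>k\<close> tends to infinity.\<close>

lemma qpoch_inverse_power_scaled:
  assumes "q \<noteq> 0"
  shows "qpoch (1 / q ^ k) q n = (\<Prod>i<n. q ^ k - q ^ i) / q ^ (n * k)"
proof -
  have "qpoch (1 / q ^ k) q n = (\<Prod>i<n. (q ^ k - q ^ i) / q ^ k)"
    using assms unfolding qpoch_def by (intro prod.cong) (auto simp: divide_simps)
  then show ?thesis
    by (simp add: prod_dividef power_mult[symmetric] mult.commute)
qed

text \<open>Letting \<open>N\<close> tend to infinity in the two telescoping lemmas gives the value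
  at \<open>j = 0\<close> and a first-order recurrence in \<open>j\<close>. Condition
  \<open>zq\<close> makes the divisors \<open>1 - z\<close> and \<open>1 - q^j / z\<close> nonzero;
  \<open>lim\<close> removes the boundary terms.\<close>

lemma well_poised_limit:
  fixes q A D E p r z :: complex
  assumes q: "q \<noteq> 0" and q1: "norm q < 1" and z: "z \<noteq> 0"
    and p: "\<And>j. p * q ^ j \<noteq> 1" and r: "\<And>j. r * q ^ j \<noteq> 1"
    and pE: "p = z * E" and rD: "r = z * D" and A: "A = z * D * E"
    and zq: "\<And>j. j \<le> m \<Longrightarrow> q ^ j \<noteq> z"
    and lim: "\<And>j. j \<le> m \<Longrightarrow>
      (\<lambda>N. qpoch D q N * qpoch E q N / (qpoch p q N * qpoch r q N) * (z / q ^ j) ^ N) \<longlonglongrightarrow> 0"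
    and jm: "j \<le> m"
  shows "(\<lambda>k. (1 - A * q ^ (2 * k)) * (qpoch D q k * qpoch E q k
             / (qpoch p q (Suc k) * qpoch r q (Suc k))) * z ^ k
             * (qpoch (1 / q ^ k) q j * qpoch (A * q ^ k) q j))
    sums (1 / (1 - z) * (qpoch q q j * qpoch D q j * qpoch E q j / qpoch (q / z) q j))"
  using jm
proof (induction j)
  case 0
  have z1: "z - 1 \<noteq> 0" using zq[of 0] by auto
  have "(\<lambda>N. (qpoch D q N * qpoch E q N / (qpoch p q N * qpoch r q N) * z ^ N - 1) / (z - 1))
      \<longlonglongrightarrow> (0 - 1) / (z - 1)"
    using lim[of 0] z1 by (intro tendsto_intros) auto
  also have "(\<lambda>N. (qpoch D q N * qpoch E q N / (qpoch p q N * qpoch r q N) * z ^ N - 1) / (z - 1))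
     = (\<lambda>N. \<Sum>k<N. (1 - A * q ^ (2 * k)) * (qpoch D q k * qpoch E q k
             / (qpoch p q (Suc k) * qpoch r q (Suc k))) * z ^ k)"
    unfolding well_poised_telescope_0[OF p r pE rD A, symmetric] using z1 by simp
  also have "(0 - 1) / (z - 1) = 1 / (1 - z)"
    using z1 by (simp add: divide_simps)
  finally show ?case
    by (simp add: sums_def)
next
  case (Suc j)
  define w where "w = (\<lambda>k. (1 - A * q ^ (2 * k)) * (qpoch D q k * qpoch E q k
             / (qpoch p q (Suc k) * qpoch r q (Suc k))) * z ^ k)"
  define \<phi> where "\<phi> = (\<lambda>j k. qpoch (1 / q ^ k) q j * qpoch (A * q ^ k) q j)"
  define \<alpha> where "\<alpha> = 1 - q ^ Suc j / z"
  define \<beta> where "\<beta> = (1 - q ^ Suc j) * (1 - D * q ^ j) * (1 - E * q ^ j)"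
  define T where "T = 1 / (1 - z) * (qpoch q q j * qpoch D q j * qpoch E q j / qpoch (q / z) q j)"
  define h where "h = (\<lambda>N. qpoch D q N * qpoch E q N / (qpoch p q N * qpoch r q N))"
  have \<alpha>: "\<alpha> \<noteq> 0"
    using zq[OF Suc.prems] z by (auto simp: \<alpha>_def)
  have q0: "(\<lambda>N. q ^ N) \<longlonglongrightarrow> 0"
    using q1 by (rule LIMSEQ_power_zero)
  define G where "G = (\<lambda>N. q ^ Suc j / z * (h N * z ^ N) * qpoch (1 / q ^ N) q (Suc j)
       * qpoch (A * q ^ N / q) q (Suc j))"
  \<comment> \<open>The factor \<open>q^(-(j+1) N)\<close> coming from
    \<open>(q^(-N); q)_(j+1)\<close> is absorbed into \<open>z^N\<close>, giving the power that
    \<open>lim\<close> controls; the other two products converge.\<close>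
  have "(\<lambda>N. q ^ Suc j / z * (h N * (z / q ^ Suc j) ^ N) * (\<Prod>i<Suc j. q ^ N - q ^ i)
       * (\<Prod>i<Suc j. 1 - A * q ^ N / q * q ^ i))
     \<longlonglongrightarrow> q ^ Suc j / z * 0 * (\<Prod>i<Suc j. 0 - q ^ i) * (\<Prod>i<Suc j. 1 - A * 0 / q * q ^ i)"
    unfolding h_def by (intro tendsto_intros lim[OF Suc.prems] q0) (use q in auto)
  also have "(\<lambda>N. q ^ Suc j / z * (h N * (z / q ^ Suc j) ^ N) * (\<Prod>i<Suc j. q ^ N - q ^ i)
       * (\<Prod>i<Suc j. 1 - A * q ^ N / q * q ^ i)) = G"
    unfolding G_def qpoch_inverse_power_scaled[OF q] qpoch_def[of "A * _ / q"]
    by (intro ext) (simp only: power_divide power_mult[symmetric] times_divide_eq_left times_divide_eq_right mult.assoc)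
  finally have G0: "G \<longlonglongrightarrow> 0" by simp
  have U: "(\<lambda>N. \<Sum>k<N. w k * \<phi> j k) \<longlonglongrightarrow> T"
    using Suc unfolding sums_def w_def \<phi>_def T_def by simp
  have "(\<lambda>N. (G N + \<beta> * (\<Sum>k<N. w k * \<phi> j k)) / \<alpha>) \<longlonglongrightarrow> (0 + \<beta> * T) / \<alpha>"
    by (intro tendsto_intros G0 U \<alpha>)
  also have "(\<lambda>N. (G N + \<beta> * (\<Sum>k<N. w k * \<phi> j k)) / \<alpha>) = (\<lambda>N. \<Sum>k<N. w k * \<phi> (Suc j) k)"
  proof
    fix N
    have "\<alpha> * (\<Sum>k<N. w k * \<phi> (Suc j) k) - \<beta> * (\<Sum>k<N. w k * \<phi> j k) = G N"
      unfolding \<alpha>_def \<beta>_def G_def w_def \<phi>_def h_def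
      by (rule well_poised_telescope_Suc[OF q z p r pE rD A])
    then show "(G N + \<beta> * (\<Sum>k<N. w k * \<phi> j k)) / \<alpha> = (\<Sum>k<N. w k * \<phi> (Suc j) k)"
      using \<alpha> by (simp add: field_simps)
  qed
  also have "(0 + \<beta> * T) / \<alpha> = 1 / (1 - z) * (qpoch q q (Suc j) * qpoch D q (Suc j) * qpoch E q (Suc j)
      / qpoch (q / z) q (Suc j))"
    by (simp add: T_def \<alpha>_def \<beta>_def qpoch_Suc mult_ac)
  finally show ?case
    by (simp add: sums_def w_def \<phi>_def)
qed

section \<open>Watson's transformation to a balanced \<open>4phi3\<close> when one parameter is
  \<open>q\<close>\<close>

theorem watson_with_parameter_q:
  fixes q A c D E P R p r z :: complex
  assumes q: "q \<noteq> 0" and q1: "norm q < 1" and z: "z \<noteq> 0"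
    and P: "\<And>j. P * q ^ j \<noteq> 1" and R: "\<And>j. R * q ^ j \<noteq> 1"
    and PR: "P * R = A * q * c" and nz: "P \<noteq> 0" "R \<noteq> 0"
    and p: "\<And>j. p * q ^ j \<noteq> 1" and r: "\<And>j. r * q ^ j \<noteq> 1"
    and pE: "p = z * E" and rD: "r = z * D" and A: "A = z * D * E"
    \<comment> \<open>For \<open>j > m\<close> the factor \<open>(q/z; q)\<^sub>j\<close> may vanish; such terms are \<open>0/0 = 0\<close> by \<open>vanish\<close>.\<close>
    and zq: "\<And>j. j \<le> m \<Longrightarrow> q ^ j \<noteq> z"
    and lim: "\<And>j. j \<le> m \<Longrightarrow>
      (\<lambda>N. qpoch D q N * qpoch E q N / (qpoch p q N * qpoch r q N) * (z / q ^ j) ^ N) \<longlonglongrightarrow> 0"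
    and vanish: "\<And>j. j > m \<Longrightarrow> qpoch c q j * qpoch D q j * qpoch E q j = 0"
  shows "(\<lambda>k. (1 - A * q ^ (2 * k)) * (qpoch D q k * qpoch E q k
             / (qpoch p q (Suc k) * qpoch r q (Suc k))) * z ^ k
            * (qpoch (A * q / P) q k * qpoch (A * q / R) q k / (qpoch P q k * qpoch R q k) * c ^ k))
    sums (1 / (1 - z) * (\<Sum>k. qpoch c q k * qpoch D q k * qpoch E q k
             / (qpoch P q k * qpoch R q k * qpoch (q / z) q k) * q ^ k))"
proof -
  define w where "w = (\<lambda>k. (1 - A * q ^ (2 * k)) * (qpoch D q k * qpoch E q k
             / (qpoch p q (Suc k) * qpoch r q (Suc k))) * z ^ k)"
  define \<phi> where "\<phi> = (\<lambda>j k. qpoch (1 / q ^ k) q j * qpoch (A * q ^ k) q j)"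
  define \<gamma> where "\<gamma> = (\<lambda>j. qpoch c q j / (qpoch q q j * qpoch P q j * qpoch R q j) * q ^ j)"
  have qq: "q * q ^ j \<noteq> 1" for j
  proof
    assume "q * q ^ j = 1"
    then have "norm q ^ Suc j = 1"
      by (metis norm_one norm_power power_Suc)
    moreover have "norm q ^ Suc j < 1"
      using q q1 by (intro power_Suc_less_one) auto
    ultimately show False by simp
  qed
  have saal: "saal_term q A c P R k j = \<gamma> j * \<phi> j k" for k j
    by (simp add: saal_term_def \<gamma>_def \<phi>_def mult_ac)
  have \<phi>0: "\<phi> j k = 0" if "k < j" for j k
    using that by (simp add: \<phi>_def qpoch_inverse_power_eq_0[OF q])
  \<comment> \<open>For \<open>k < j\<close> the factor \<open>\<phi> j k\<close> is zero. For
    \<open>k \<ge> j\<close> a zero of \<open>(c; q)_j\<close> lies in \<open>\<gamma> j\<close>,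
    while a zero of \<open>(D; q)_j\<close> or \<open>(E; q)_j\<close> persists to index
    \<open>k\<close> and lies in \<open>w k\<close>.\<close>
  have zero: "\<gamma> j * (w k * \<phi> j k) = 0" if "j > m" for j k
  proof (cases "k < j")
    case False
    have "qpoch c q j = 0 \<or> qpoch D q k = 0 \<or> qpoch E q k = 0"
      using vanish[OF that] False qpoch_eq_0_mono[of _ q j k] by auto
    then show ?thesis
      by (auto simp: \<gamma>_def w_def)
  qed (simp add: \<phi>0)
  have expand: "w k * (qpoch (A * q / P) q k * qpoch (A * q / R) q k / (qpoch P q k * qpoch R q k) * c ^ k)
      = (\<Sum>j\<le>m. \<gamma> j * (w k * \<phi> j k))" for k
  proof -
    have "w k * (qpoch (A * q / P) q k * qpoch (A * q / R) q k / (qpoch P q k * qpoch R q k) * c ^ k)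
        = (\<Sum>j\<le>k. \<gamma> j * (w k * \<phi> j k))"
      unfolding q_saalschuetz[OF q qq P R PR nz, symmetric] saal sum_distrib_left
      by (simp add: mult_ac)
    \<comment> \<open>Passing through \<open>max k m\<close> replaces the range
      \<open>j \<le> k\<close> by one independent of \<open>k\<close>, so that the infinite sum over
      \<open>k\<close> can be taken inside a fixed finite sum over \<open>j\<close>.\<close>
    also have "\<dots> = (\<Sum>j\<le>max k m. \<gamma> j * (w k * \<phi> j k))"
      by (intro sum.mono_neutral_left) (auto simp: \<phi>0)
    also have "\<dots> = (\<Sum>j\<le>m. \<gamma> j * (w k * \<phi> j k))"
      by (intro sum.mono_neutral_right) (use zero in auto)
    finally show ?thesis .
  qed
  have "(\<lambda>k. \<Sum>j\<le>m. \<gamma> j * (w k * \<phi> j k)) sums (\<Sum>j\<le>m. \<gamma> j *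
      (1 / (1 - z) * (qpoch q q j * qpoch D q j * qpoch E q j / qpoch (q / z) q j)))"
    unfolding w_def \<phi>_def
    by (intro sums_sum sums_mult well_poised_limit[OF q q1 z p r pE rD A zq lim]) auto
  also have "(\<Sum>j\<le>m. \<gamma> j * (1 / (1 - z) * (qpoch q q j * qpoch D q j * qpoch E q j / qpoch (q / z) q j)))
      = 1 / (1 - z) * (\<Sum>j\<le>m. qpoch c q j * qpoch D q j * qpoch E q j
             / (qpoch P q j * qpoch R q j * qpoch (q / z) q j) * q ^ j)"
    unfolding sum_distrib_left
    by (intro sum.cong) (auto simp: \<gamma>_def qpoch_nonzero[OF qq] mult_ac)
  also have "(\<Sum>j\<le>m. qpoch c q j * qpoch D q j * qpoch E q j
             / (qpoch P q j * qpoch R q j * qpoch (q / z) q j) * q ^ j)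
       = (\<Sum>k. qpoch c q k * qpoch D q k * qpoch E q k
             / (qpoch P q k * qpoch R q k * qpoch (q / z) q k) * q ^ k)"
    by (intro suminf_finite[symmetric]) (use vanish in auto)
  finally show ?thesis
    unfolding expand[symmetric] unfolding w_def .
qed

section \<open>Specialisation to the series \<open>rho\<close>\<close>

theorem theorem3p2:
  fixes q a b c d e :: complex
  assumes "0 < norm q" and "norm q < 1"
    and "0 < norm (c * d * e)" and "norm (c * d * e) < norm (a * b * q)"
    and "\<And>x m n. x \<in> {c, d, e} \<Longrightarrow> x \<noteq> - a / q ^ m \<and> x \<noteq> - b / q ^ n"
    \<comment> \<open>implicit in the series: no factor of \<open>(-aq;q)\<^sub>k\<close> in the denominators vanishes\<close>
    and "\<And>m. - a * q \<noteq> 1 / q ^ m"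
    and "\<exists>m. c = 1 / q ^ m \<or> - a * q / d = 1 / q ^ m \<or> - a * q / e = 1 / q ^ m"
  shows "rho q a b c d e =
    (1 + b) / ((b + c) * (1 - d * e / (a * b * q)))
      * (\<Sum>k. qpochs [c, - a * q / d, - a * q / e] q k
             / qpochs [- a * q, - c * q / b, a * b * q ^ 2 / (d * e)] q k * q ^ k)"
proof -
  define A D E where "A = a * q / b" and "D = - a * q / d" and "E = - a * q / e"
  \<comment> \<open>Chosen so that \<open>A q / P = -q/b\<close>, \<open>A q / R = -aq/c\<close>,
    \<open>p = A / D\<close> and \<open>r = A / E\<close>.\<close>
  define P R p r where "P = - a * q" and "R = - c * q / b" and "p = - d / b" and "r = - e / b"
  define z where "z = d * e / (a * b * q)"
  have nz: "q \<noteq> 0" "a \<noteq> 0" "b \<noteq> 0" "c \<noteq> 0" "d \<noteq> 0" "e \<noteq> 0"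
    using assms(1,3,4) by auto
  have z: "z \<noteq> 0" using nz by (simp add: z_def)
  have not_b: "- x / b * q ^ n \<noteq> 1" if "x \<in> {c, d, e}" for x n
    using assms(5)[OF that, of 0 n] nz by (auto simp: field_simps)
  have P: "P * q ^ j \<noteq> 1" for j
    using assms(6)[of j] nz by (simp add: P_def field_simps)
  have R: "R * q ^ j \<noteq> 1" for j
    using not_b[of c "Suc j"] by (simp add: R_def mult_ac)
  have p: "p * q ^ j \<noteq> 1" and r: "r * q ^ j \<noteq> 1" for j
    using not_b[of d j] not_b[of e j] by (auto simp: p_def r_def)
  have rel: "P * R = A * q * c" "p = z * E" "r = z * D" "A = z * D * E" "P \<noteq> 0" "R \<noteq> 0"
    using nz by (simp_all add: P_def R_def A_def D_def E_def p_def r_def z_def field_simps)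
  have zc: "norm z * norm c < 1"
    using assms(4) nz by (simp add: z_def norm_mult norm_divide divide_simps mult_ac)
  obtain m where m: "c = 1 / q ^ m \<or> D = 1 / q ^ m \<or> E = 1 / q ^ m"
    using assms(7) unfolding D_def E_def by blast
  define h where "h = (\<lambda>N. qpoch D q N * qpoch E q N / (qpoch p q N * qpoch r q N))"
  have vanish: "qpoch c q j * qpoch D q j * qpoch E q j = 0" if "j > m" for j
    using m that qpoch_inverse_power_eq_0[OF nz(1) that] by auto
  have "(\<forall>j\<le>m. q ^ j \<noteq> z) \<and> (\<forall>j\<le>m. (\<lambda>N. h N * (z / q ^ j) ^ N) \<longlonglongrightarrow> 0)"
  proof (cases "c = 1 / q ^ m")
    case True
    \<comment> \<open>This one bound gives both claims: \<open>z\<close> differs from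
      \<open>q^j\<close>, and \<open>(z / q^j)^N\<close> tends to 0 while \<open>h\<close>
      converges.\<close>
    have small: "norm z < norm q ^ j" if "j \<le> m" for j
    proof -
      have "norm z < norm q ^ m"
        using zc nz True by (simp add: norm_divide norm_power divide_simps)
      also have "\<dots> \<le> norm q ^ j"
        using that assms(2) by (intro power_decreasing) auto
      finally show ?thesis .
    qed
    have "(\<lambda>N. h N * (z / q ^ j) ^ N) \<longlonglongrightarrow> 0" if "j \<le> m" for j
    proof -
      have "h \<longlonglongrightarrow> qpoch_inf D q * qpoch_inf E q / (qpoch_inf p q * qpoch_inf r q)"
        unfolding h_def using qpoch_inf_nonzero[OF assms(2) p] qpoch_inf_nonzero[OF assms(2) r]
        by (intro tendsto_intros qpoch_tendsto assms(2)) simp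
      moreover have "(\<lambda>N. (z / q ^ j) ^ N) \<longlonglongrightarrow> 0"
        using small[OF that] nz by (intro LIMSEQ_power_zero) (simp add: norm_divide norm_power)
      ultimately show ?thesis
        using tendsto_mult by fastforce
    qed
    moreover have "q ^ j \<noteq> z" if "j \<le> m" for j
      using small[OF that] by (auto simp: norm_power)
    ultimately show ?thesis by blast
  next
    case False
    then have DE: "D = 1 / q ^ m \<or> E = 1 / q ^ m"
      using m by blast
    have "h N * (z / q ^ j) ^ N = 0" if "m < N" for N j
      using DE qpoch_inverse_power_eq_0[OF nz(1) that] by (auto simp: h_def)
    then have "(\<lambda>N. h N * (z / q ^ j) ^ N) \<longlonglongrightarrow> 0" for j
      by (intro tendsto_eventually eventually_mono[OF eventually_gt_at_top[of m]]) auto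
    \<comment> \<open>In this case no bound on \<open>z\<close> is available; instead
      \<open>z = q^j\<close> would give \<open>r q^(m-j) = 1\<close> or
      \<open>p q^(m-j) = 1\<close>, since \<open>r = z D\<close> and \<open>p = z E\<close>, so a
      denominator factor would vanish.\<close>
    moreover have "q ^ j \<noteq> z" if "j \<le> m" for j
    proof
      assume eq: "q ^ j = z"
      have "q ^ m = q ^ j * q ^ (m - j)"
        using that by (simp flip: power_add)
      then have "z * q ^ (m - j) = q ^ m"
        by (simp add: eq)
      then have "D = 1 / q ^ m \<Longrightarrow> r * q ^ (m - j) = 1" "E = 1 / q ^ m \<Longrightarrow> p * q ^ (m - j) = 1"
        using nz by (simp_all add: rel field_simps)
      with DE p r show False by blast
    qed
    ultimately show ?thesis by blast
  qed
  then have zq: "\<And>j. j \<le> m \<Longrightarrow> q ^ j \<noteq> z"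
    and lim: "\<And>j. j \<le> m \<Longrightarrow> (\<lambda>N. qpoch D q N * qpoch E q N / (qpoch p q N * qpoch r q N) * (z / q ^ j) ^ N) \<longlonglongrightarrow> 0"
    by (auto simp: h_def)
  note S = watson_with_parameter_q[OF nz(1) assms(2) z P R rel(1,5,6) p r rel(2-4) zq lim vanish]
  have bc: "b + c \<noteq> 0"
    using not_b[of c 0] nz by (auto simp: field_simps add_eq_0_iff2)
  \<comment> \<open>Removing the first factors of \<open>(-1/b; q)_(k+1)\<close> and
    \<open>(-c/b; q)_(k+1)\<close> produces the prefactor \<open>(1 + b) / (b + c)\<close>; the
    products for \<open>d\<close> and \<open>e\<close> keep length \<open>k + 1\<close>, as in the
    weight.\<close>
  have term_eq: "(1 - a * q ^ (2 * k + 1) / b)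
          * (qpoch (- 1 / b) q (k + 1) / qpochs [- c / b, - d / b, - e / b] q (k + 1))
          * (qpochs [- a * q / c, - a * q / d, - a * q / e] q k / qpoch (- a * q) q k)
          * (c * d * e / (a * b * q)) ^ k
     = (1 + b) / (b + c) * ((1 - A * q ^ (2 * k)) * (qpoch D q k * qpoch E q k
             / (qpoch p q (Suc k) * qpoch r q (Suc k))) * z ^ k
            * (qpoch (A * q / P) q k * qpoch (A * q / R) q k / (qpoch P q k * qpoch R q k) * c ^ k))" for k
  proof -
    have AP: "A * q / P = - q / b" and AR: "A * q / R = - a * q / c"
      using nz by (simp_all add: A_def P_def R_def)
    have "qpoch (- 1 / b) q (Suc k) = (1 + 1 / b) * qpoch (- q / b) q k"
      "qpoch (- c / b) q (Suc k) = (1 + c / b) * qpoch R q k"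
      by (simp_all add: qpoch_Suc_left R_def)
    moreover have "(1 + 1 / b) / (1 + c / b) = (1 + b) / (b + c)"
      using nz bc by (simp add: divide_simps add_ac)
    ultimately have f: "qpoch (- 1 / b) q (Suc k) / qpoch (- c / b) q (Suc k)
        = (1 + b) / (b + c) * (qpoch (- q / b) q k / qpoch R q k)"
      by (metis times_divide_times_eq)
    have A1: "a * q ^ (2 * k + 1) / b = A * q ^ (2 * k)" and z1: "(c * d * e / (a * b * q)) ^ k = z ^ k * c ^ k"
      by (simp_all add: A_def z_def power_mult_distrib[symmetric] mult_ac)
    have "qpoch (- 1 / b) q (k + 1) / qpochs [- c / b, - d / b, - e / b] q (k + 1)
      = (qpoch (- 1 / b) q (Suc k) / qpoch (- c / b) q (Suc k)) / (qpoch p q (Suc k) * qpoch r q (Suc k))"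
      by (simp add: qpochs_def p_def r_def mult_ac)
    then show ?thesis
      unfolding A1 z1 f AP AR by (simp add: qpochs_def D_def E_def P_def mult_ac)
  qed
  have qz: "a * b * q ^ 2 / (d * e) = q / z"
    using nz by (simp add: z_def power2_eq_square)
  have "rho q a b c d e = (1 + b) / (b + c) * (1 / (1 - z) * (\<Sum>k. qpoch c q k * qpoch D q k * qpoch E q k
             / (qpoch P q k * qpoch R q k * qpoch (q / z) q k) * q ^ k))"
    unfolding rho_def term_eq by (intro sums_unique[symmetric] sums_mult S)
  then show ?thesis
    unfolding qz by (simp add: qpochs_def D_def E_def P_def R_def z_def mult_ac)
qed

end
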